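(* Let $\zeta$ be a Pisot number of degree $k$ with Pisot polynomial $P_{\zeta}$, and let $q$ be a prime. Then there exists an element of $\mathscr{M}_{\zeta}\setminus\mathbb{Z}[\zeta]$ whose denominator in reduced form is divisible by $q$ if and only if $q$ divides $\Delta(P_{\zeta})\cdot P_{\zeta}(0)$.
   Context: A Pisot number is a real algebraic integer $\zeta>1$ all of whose conjugates other than $\zeta$ lie strictly inside the unit circle of $\mathbb{C}$; its Pisot polynomial $P_{\zeta}$ is its (monic, integer) minimal polynomial. For real $\zeta>1$, $\mathscr{M}_{\zeta}$ denotes the set of all $\alpha\in\mathbb{R}$ with $\Vert\alpha\zeta^{n}\Vert\to0$ as $n\to\infty$, where $\Vert x\Vert$ is the distance from $x$ to the nearest integer; one has $\mathscr{M}_{\zeta}\subset\mathbb{Q}(\zeta)$. Every $a\in\mathbb{Q}(\zeta)$ can be written in reduced form $a=(r_{0}+r_{1}\zeta+\cdots+r_{k-1}\zeta^{k-1})/N$ with integers $r_{j},N$, $N\ge1$, and $\gcd(r_{0},\dots,r_{k-1},N)=1$; $N$ is called the denominator of $a$ in reduced form. For a monic polynomial $P$ with complex roots $x_{1},\dots,x_{k}$, its discriminant is $\Delta(P)=\prod_{i<j}(x_{i}-x_{j})^{2}\in\mathbb{Z}$. *)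

theory Defs
  imports "HOL-Computational_Algebra.Computational_Algebra" "HOL-Combinatorics.List_Permutation"
begin

definition is_min_poly :: "rat poly \<Rightarrow> real \<Rightarrow> bool" where
  "is_min_poly p x \<longleftrightarrow> lead_coeff p = 1 \<and> poly (map_poly of_rat p) x = 0 \<and>
     (\<forall>g::rat poly. g \<noteq> 0 \<longrightarrow> poly (map_poly of_rat g) x = 0 \<longrightarrow> degree p \<le> degree g)"

definition conjugates :: "real \<Rightarrow> complex set" where
  "conjugates x = {z. \<exists>p. is_min_poly p x \<and> poly (map_poly of_rat p) z = 0}"

definition pisot :: "real \<Rightarrow> bool" where
  "pisot \<zeta> \<longleftrightarrow> algebraic_int \<zeta> \<and> 1 < \<zeta> \<and> (\<forall>z \<in> conjugates \<zeta> - {of_real \<zeta>}. norm z < 1)"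

definition is_pisot_poly :: "int poly \<Rightarrow> real \<Rightarrow> bool" where
  "is_pisot_poly P \<zeta> \<longleftrightarrow> is_min_poly (map_poly of_int P) \<zeta>"

definition nearest_int_dist :: "real \<Rightarrow> real" where
  "nearest_int_dist x = \<bar>x - of_int (round x)\<bar>"

definition M_set :: "real \<Rightarrow> real set" where
  "M_set \<zeta> = {\<alpha>. (\<lambda>n. nearest_int_dist (\<alpha> * \<zeta> ^ n)) \<longlonglongrightarrow> 0}"

definition int_adjoin :: "real \<Rightarrow> real set" where
  "int_adjoin \<zeta> = range (\<lambda>f::int poly. poly (map_poly of_int f) \<zeta>)"

text \<open>\<open>N\<close> is the denominator of \<open>a\<close> with respect to \<open>1, \<zeta>, \<dots>, \<zeta>\<^sup>k\<^sup>-\<^sup>1\<close>.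
  If \<open>k\<close> is the degree of \<open>\<zeta>\<close>, these powers are linearly independent over the rationals,
  so at most one \<open>N\<close> satisfies this, and one does for every \<open>a\<close> in the field generated by \<open>\<zeta>\<close>.\<close>

definition has_denominator :: "real \<Rightarrow> nat \<Rightarrow> real \<Rightarrow> nat \<Rightarrow> bool" where
  "has_denominator \<zeta> k a N \<longleftrightarrow> N \<ge> 1 \<and>
     (\<exists>r :: nat \<Rightarrow> int. a = (\<Sum>j<k. of_int (r j) * \<zeta> ^ j) / of_nat N \<and>
        Gcd (insert (int N) (r ` {..<k})) = 1)"

definition root_diff_prod :: "complex list \<Rightarrow> complex" where
  "root_diff_prod xs = (\<Prod>(i, j) \<in> {(i, j). i < j \<and> j < length xs}. (xs ! i - xs ! j)\<^sup>2)"

text \<open>For monic \<open>p\<close>; the value does not depend on the chosen enumeration of the roots,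
  as the lemma \<open>discriminant_eq\<close> below shows.\<close>

definition discriminant :: "complex poly \<Rightarrow> complex" where
  "discriminant p = root_diff_prod (SOME xs. mset xs = proots p)"

lemma root_diff_prod_cong:
  assumes "mset xs = mset ys"
  shows "root_diff_prod xs = root_diff_prod ys"
proof -
  let ?n = "length xs"
  have len: "length ys = ?n" using assms by (metis size_mset)
  obtain f where f: "bij_betw f {..<?n} {..<?n}" and fv: "\<And>i. i < ?n \<Longrightarrow> xs ! i = ys ! f i"
    using permutation_Ex_bij[OF assms] len by auto
  let ?A = "{(i, j). i < j \<and> j < ?n}"
  let ?h = "\<lambda>(i, j). (min (f i) (f j), max (f i) (f j))"
  have inj: "f i = f j \<longleftrightarrow> i = j" if "i < ?n" "j < ?n" for i j
    using f that by (auto simp: bij_betw_def inj_on_def)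
  have range: "f i < ?n" if "i < ?n" for i
    using f that by (auto simp: bij_betw_def)
  have fin: "finite ?A" by (rule finite_subset[of _ "{..<?n} \<times> {..<?n}"]) auto
  have h1: "?h ` ?A \<subseteq> ?A"
  proof -
    have "?h (i, j) \<in> ?A" if "i < j" "j < ?n" for i j
    proof -
      have "f i \<noteq> f j" using inj[of i j] that by simp
      then show ?thesis using range[of i] range[of j] that by (auto simp: min_def max_def)
    qed
    then show ?thesis by auto
  qed
  have h2: "inj_on ?h ?A"
  proof (rule inj_onI)
    fix a b assume ab: "a \<in> ?A" "b \<in> ?A" "?h a = ?h b"
    obtain i j k l where [simp]: "a = (i, j)" "b = (k, l)" by (cases a, cases b)
    have lt: "i < j" "j < ?n" "k < l" "l < ?n" using ab by auto
    have "f i = f k \<and> f j = f l \<or> f i = f l \<and> f j = f k"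
      using ab(3) by (auto simp: min_def max_def split: if_splits)
    then have "i = k \<and> j = l \<or> i = l \<and> j = k"
      using lt inj[of i k] inj[of j l] inj[of i l] inj[of j k] by auto
    then show "a = b" using lt by auto
  qed
  have img: "?h ` ?A = ?A"
    by (rule card_subset_eq[OF fin h1]) (rule card_image[OF h2])
  have "root_diff_prod ys = (\<Prod>(i, j) \<in> ?h ` ?A. (ys ! i - ys ! j)\<^sup>2)"
    unfolding root_diff_prod_def len img ..
  also have "\<dots> = (\<Prod>a \<in> ?A. (\<lambda>(i, j). (ys ! i - ys ! j)\<^sup>2) (?h a))"
    by (subst prod.reindex[OF h2]) simp
  also have "\<dots> = (\<Prod>(i, j) \<in> ?A. (xs ! i - xs ! j)\<^sup>2)"
    by (rule prod.cong) (auto simp: fv min_def max_def power2_commute)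
  finally show ?thesis unfolding root_diff_prod_def by simp
qed

lemma discriminant_eq:
  "discriminant (\<Prod>x\<leftarrow>xs. [:- x, 1:]) = root_diff_prod xs"
proof -
  let ?p = "\<Prod>x\<leftarrow>xs. [:- x, 1:]"
  have eq: "mset xs = proots ?p"
  proof (induction xs)
    case (Cons x xs)
    have "(\<Prod>x\<leftarrow>xs. [:- x, 1:]) \<noteq> 0" by (auto simp: prod_list_zero_iff)
    then show ?case using Cons by (simp add: proots_mult del: mult_pCons_left)
  qed simp
  have "mset (SOME ys. mset ys = proots ?p) = proots ?p"
    by (rule someI[of "\<lambda>ys. mset ys = proots ?p", OF eq])
  then show ?thesis
    unfolding discriminant_def using eq by (intro root_diff_prod_cong) simp
qed

end

theory Submission
  imports Defs "Jordan_Normal_Form.Char_Poly"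
begin

text \<open>Let \<open>W = X P'\<close>. Its norm, the product of \<open>W(x)\<close> over the roots \<open>x\<close> of \<open>P\<close>, is an integer \<open>D\<close> equal to
  \<open>\<Delta>(P) P(0)\<close> up to sign, and \<open>D\<close> is a multiple of \<open>W(\<zeta>)\<close> in \<open>\<int>[\<zeta>]\<close>.
  If \<open>\<alpha>\<close> lies in \<open>M_set \<zeta>\<close>, then \<open>\<alpha> W(\<zeta>)\<^sup>m\<close> lies in \<open>\<int>[\<zeta>]\<close> for some \<open>m\<close>, hence so does
  \<open>\<alpha> D\<^sup>m\<close>, and the denominator of \<open>\<alpha>\<close> has no prime factors besides those of \<open>D\<close>.
  Conversely, \<open>1 / W(\<zeta>)\<close> lies in \<open>M_set \<zeta>\<close>; if \<open>N\<close> is its denominator, then taking norms in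
  \<open>W(\<zeta>) R(\<zeta>) = N\<close> shows that \<open>D\<close> divides \<open>N\<^sup>k\<close>, so every prime factor of \<open>D\<close> divides \<open>N\<close>.\<close>

section \<open>Integer polynomials: division with remainder and values from coefficients\<close>

text \<open>Pseudo-division scales \<open>F\<close> by a power of the leading coefficient of
  \<open>P\<close>. That is 1 here, so quotient and remainder stay integral.\<close>

lemma monic_division:
  fixes P F :: "int poly"
  assumes "lead_coeff P = 1" "degree P > 0"
  obtains Q R where "F = P * Q + R" "degree R < degree P"
proof -
  obtain Q R where QR: "pseudo_divmod F P = (Q, R)"
    by (cases "pseudo_divmod F P") auto
  have "P \<noteq> 0" using assms by auto
  from pseudo_divmod[OF this QR] assms show ?thesis
    by (intro that[of Q R]) auto
qed

lemma poly_eq_sum_lessThan: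
  fixes p :: "'a::comm_semiring_1 poly"
  assumes "degree p < k"
  shows "poly p x = (\<Sum>j<k. coeff p j * x ^ j)"
proof -
  have "(\<Sum>j<k. coeff p j * x ^ j) = (\<Sum>j\<le>degree p. coeff p j * x ^ j)"
    using assms by (intro sum.mono_neutral_right) (auto simp: coeff_eq_0)
  then show ?thesis by (simp add: poly_altdef)
qed

lemma degree_sum_monom_less:
  assumes "0 < k"
  shows "degree (\<Sum>j<k. monom (c j) j) < k"
  by (rule degree_sum_less[OF _ assms]) 
     (auto intro: le_less_trans[OF degree_monom_le])

lemma coeff_sum_monom_less: "i < k \<Longrightarrow> coeff (\<Sum>j<k. monom (c j) j) i = c i"
  by (simp add: coeff_sum)

section \<open>The norm of a polynomial modulo \<open>P\<close> as a determinant\<close>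

text \<open>A kernel vector lists the coefficients of a polynomial of degree below
  \<open>length xs\<close> that vanishes at all the distinct elements of \<open>xs\<close>, so it is
  zero.\<close>

lemma vandermonde_det_nonzero:
  fixes xs :: "'a::field list"
  assumes "distinct xs"
  shows "det (mat (length xs) (length xs) (\<lambda>(i, j). xs ! i ^ j)) \<noteq> 0"
proof
  let ?k = "length xs"
  let ?V = "mat ?k ?k (\<lambda>(i, j). xs ! i ^ j)"
  assume "det ?V = 0"
  then obtain v where v: "v \<in> carrier_vec ?k" "v \<noteq> 0\<^sub>v ?k" "?V *\<^sub>v v = 0\<^sub>v ?k"
    by (subst (asm) det_0_iff_vec_prod_zero_field[of _ ?k]) auto
  have "?k \<noteq> 0" using v by (auto intro: eq_vecI)
  define p where "p = (\<Sum>j<?k. monom (v $ j) j)"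
  have deg: "degree p < ?k"
    unfolding p_def using \<open>?k \<noteq> 0\<close> by (intro degree_sum_monom_less) auto
  have cf: "coeff p j = v $ j" if "j < ?k" for j
    unfolding p_def using that by (rule coeff_sum_monom_less)
  have "poly p (xs ! i) = 0" if i: "i < ?k" for i
  proof -
    have "(?V *\<^sub>v v) $ i = (\<Sum>j<?k. xs ! i ^ j * v $ j)"
      using i v(1) by (simp add: scalar_prod_def atLeast0LessThan)
    then show ?thesis using v i by (simp add: poly_eq_sum_lessThan[OF deg] cf mult.commute)
  qed
  then have sub: "set xs \<subseteq> {x. poly p x = 0}" by (auto simp: in_set_conv_nth)
  have "p = 0"
  proof (rule ccontr)
    assume "p \<noteq> 0"
    then have "card (set xs) \<le> degree p"
      using card_mono[OF poly_roots_finite sub] poly_roots_degree[of p] by fastforce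
    then show False using deg distinct_card[OF assms] by simp
  qed
  then have "v = 0\<^sub>v ?k" using cf v by (intro eq_vecI) (auto simp flip: cf)
  then show False using v by simp
qed

text \<open>\<open>D\<close> is the determinant of multiplication by \<open>W\<close> on \<open>\<int>[X]/(P)\<close>, which a Vandermonde matrix
  diagonalizes over the complex numbers; \<open>A\<close> comes from the adjugate matrix.\<close>

lemma norm_exists:
  fixes P W :: "int poly" and xs :: "complex list"
  assumes monic: "lead_coeff P = 1" and deg: "degree P > 0"
    and P: "of_int_poly P = (\<Prod>x\<leftarrow>xs. [:- x, 1:])" and dist: "distinct xs"
  obtains D :: int and A where "of_int D = (\<Prod>x\<leftarrow>xs. poly (of_int_poly W) x)" "P dvd W * A - [:D:]"
proof -
  define k where "k = degree P"
  have len: "length xs = k"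
    using arg_cong[OF P, of degree] by (simp add: k_def degree_linear_factors)
  have root: "poly (of_int_poly P) x = 0" if "x \<in> set xs" for x
    using that unfolding P by (simp add: poly_prod_list o_def prod_list_zero_iff image_iff)
  \<comment> \<open>The image of the basis element \<open>X^j\<close> under multiplication by
    \<open>W\<close>, reduced modulo \<open>P\<close>. Its coefficients form column \<open>j\<close>
    of \<open>M\<close>.\<close>
  have "\<forall>j. \<exists>R. P dvd W * monom 1 j - R \<and> degree R < k"
  proof
    fix j
    obtain Q R where "W * monom 1 j = P * Q + R" "degree R < degree P"
      using monic_division[OF monic deg] .
    then show "\<exists>R. P dvd W * monom 1 j - R \<and> degree R < k"
      by (intro exI[of _ R]) (auto simp: k_def)
  qed
  then obtain R where R: "\<And>j. P dvd W * monom 1 j - R j" and Rdeg: "\<And>j. degree (R j) < k"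
    by metis
  define M where "M = mat k k (\<lambda>(i, j). coeff (R j) i)"
  define D where "D = det M"
  define V where "V = mat k k (\<lambda>(i, j). xs ! i ^ j)"
  define L where "L = mat k k (\<lambda>(i, j). if i = j then poly (of_int_poly W) (xs ! i) else 0)"
  have carr: "M \<in> carrier_mat k k" "V \<in> carrier_mat k k" "L \<in> carrier_mat k k"
    by (auto simp: M_def V_def L_def)
  have eval: "poly (of_int_poly (R j)) (xs ! i) = poly (of_int_poly W) (xs ! i) * xs ! i ^ j"
    if "i < k" for i j
  proof -
    obtain Q where Q: "W * monom 1 j - R j = P * Q" using R by (auto elim: dvdE)
    have "poly (of_int_poly (W * monom 1 j - R j)) (xs ! i) = 0"
      unfolding Q using root[of "xs ! i"] that len by (simp add: hom_distribs)
    then show ?thesis by (simp add: hom_distribs poly_monom)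
  qed
  \<comment> \<open>Row \<open>i\<close> of \<open>V\<close> turns a coefficient vector into the
    value at the root \<open>xs ! i\<close>, where multiplication by \<open>W\<close> is scaling by
    the value of \<open>W\<close>.\<close>
  have "V * map_mat of_int M = L * V"
  proof (rule eq_matI)
    fix i j assume "i < dim_row (L * V)" "j < dim_col (L * V)"
    then have ij: "i < k" "j < k" using carr by auto
    have "(V * map_mat of_int M) $$ (i, j) = (\<Sum>l<k. xs ! i ^ l * of_int (coeff (R j) l))"
      using ij by (simp add: V_def M_def scalar_prod_def atLeast0LessThan)
    also have "\<dots> = poly (of_int_poly (R j)) (xs ! i)"
      using Rdeg[of j] by (subst poly_eq_sum_lessThan[of _ k]) (auto simp: mult.commute)
    also have "\<dots> = poly (of_int_poly W) (xs ! i) * xs ! i ^ j" by (rule eval[OF ij(1)])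
    also have "\<dots> = (\<Sum>l<k. (if i = l then poly (of_int_poly W) (xs ! i) else 0) * xs ! l ^ j)"
      using ij by (simp add: if_distrib[of "\<lambda>x. x * _"] sum.delta cong: if_cong)
    also have "\<dots> = (L * V) $$ (i, j)"
      using ij by (simp add: V_def L_def scalar_prod_def atLeast0LessThan)
    finally show "(V * map_mat of_int M) $$ (i, j) = (L * V) $$ (i, j)" .
  qed (use carr in auto)
  then have "det V * det (map_mat of_int M) = det L * det V"
    using carr by (metis det_mult map_carrier_mat)
  moreover have "det V \<noteq> 0"
    using vandermonde_det_nonzero[OF dist] by (simp add: V_def len)
  ultimately have "of_int D = det L" by (simp add: D_def)
  also have "det L = prod_list (diag_mat L)"
    using carr by (intro det_upper_triangular[of _ k]) (auto simp: L_def)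
  also have "diag_mat L = map (poly (of_int_poly W)) xs"
    by (intro nth_equalityI) (auto simp: diag_mat_def L_def len)
  finally have D: "of_int D = (\<Prod>x\<leftarrow>xs. poly (of_int_poly W) x)" .
  \<comment> \<open>Column 0 of \<open>adj_mat M\<close> is sent by \<open>M\<close> to
    \<open>D\<close> times the first unit vector. Read as coefficients, it is a polynomial whose
    product with \<open>W\<close> is the constant \<open>D\<close> modulo \<open>P\<close>.\<close>
  define a where "a j = adj_mat M $$ (j, 0)" for j
  define A where "A = (\<Sum>j<k. monom (a j) j)"
  have k0: "0 < k" using deg k_def by simp
  have ac: "adj_mat M \<in> carrier_mat k k" by (rule adj_mat[OF carr(1)])
  have "(\<Sum>j<k. Polynomial.smult (a j) (R j)) = [:D:]"
  proof (rule poly_eqI)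
    fix i
    show "coeff (\<Sum>j<k. Polynomial.smult (a j) (R j)) i = coeff [:D:] i"
    proof (cases "i < k")
      case True
      have "(M * adj_mat M) $$ (i, 0) = (\<Sum>j<k. coeff (R j) i * a j)"
        using True k0 ac by (simp add: M_def a_def scalar_prod_def atLeast0LessThan)
      moreover have "(M * adj_mat M) $$ (i, 0) = (if i = 0 then D else 0)"
        using True k0 by (simp add: adj_mat(2)[OF carr(1)] D_def)
      ultimately show ?thesis by (simp add: coeff_sum coeff_const mult.commute)
    next
      case False
      then have "coeff (R j) i = 0" for j using Rdeg[of j] by (intro coeff_eq_0) auto
      then show ?thesis using False k0 by (simp add: coeff_sum coeff_const)
    qed
  qed
  moreover have "W * A - (\<Sum>j<k. Polynomial.smult (a j) (R j)) = (\<Sum>j<k. Polynomial.smult (a j) (W * monom 1 j - R j))"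
    by (simp add: A_def sum_distrib_left smult_diff_right sum_subtractf flip: mult_smult_right)
       (simp add: smult_monom)
  moreover have "P dvd (\<Sum>j<k. Polynomial.smult (a j) (W * monom 1 j - R j))"
    by (intro dvd_sum dvd_smult R)
  ultimately have "P dvd W * A - [:D:]" by simp
  with D show ?thesis by (rule that)
qed

section \<open>The discriminant through values of the derivative\<close>

text \<open>Pairs of indices are split by whether the smaller one is 0. This is the induction step
  for discriminants.\<close>

lemma root_diff_prod_Cons:
  "root_diff_prod (x # xs) = (\<Prod>y\<leftarrow>xs. (x - y)\<^sup>2) * root_diff_prod xs"
proof -
  define A where "A = {(i, j). i < j \<and> j < length xs}"
  have fin: "finite A" unfolding A_def by (rule finite_subset[of _ "{..<length xs} \<times> {..<length xs}"]) auto
  let ?f = "\<lambda>(i, j). ((x # xs) ! i - (x # xs) ! j)\<^sup>2"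
  have "{(i, j). i < j \<and> j < length (x # xs)} = (\<lambda>j. (0, Suc j)) ` {..<length xs} \<union> map_prod Suc Suc ` A"
    (is "?L = ?R")
  proof
    show "?L \<subseteq> ?R"
    proof
      fix p assume "p \<in> ?L"
      then obtain i j where p: "p = (i, Suc j)" "i < Suc j" "j < length xs"
        by (cases p, case_tac b) auto
      then show "p \<in> ?R" by (cases i) (auto simp: A_def image_iff)
    qed
  qed (auto simp: A_def)
  then have "root_diff_prod (x # xs) = prod ?f ((\<lambda>j. (0, Suc j)) ` {..<length xs}) * prod ?f (map_prod Suc Suc ` A)"
    unfolding root_diff_prod_def using fin by (subst prod.union_disjoint[symmetric]) auto
  also have "prod ?f ((\<lambda>j. (0, Suc j)) ` {..<length xs}) = (\<Prod>j<length xs. (x - xs ! j)\<^sup>2)"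
    by (subst prod.reindex) (auto intro: inj_onI)
  also have "\<dots> = (\<Prod>y\<leftarrow>xs. (x - y)\<^sup>2)"
    by (simp add: prod.list_conv_set_nth atLeast0LessThan)
  also have "prod ?f (map_prod Suc Suc ` A) = root_diff_prod xs"
    unfolding root_diff_prod_def A_def[symmetric]
    by (subst prod.reindex) (auto intro!: inj_onI prod.cong)
  finally show ?thesis .
qed

lemma prod_list_mult_distrib:
  fixes f g :: "'a \<Rightarrow> 'b::comm_monoid_mult"
  shows "(\<Prod>x\<leftarrow>xs. f x * g x) = (\<Prod>x\<leftarrow>xs. f x) * (\<Prod>x\<leftarrow>xs. g x)"
  by (induction xs) (simp_all add: ac_simps)

text \<open>The derivative at a root is the product of the differences to the other roots, so each
  pair of positions contributes \<open>(x - y) * (y - x)\<close>, the negative of a square. The sign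
  is left unspecified because divisibility does not see it.\<close>

lemma prod_pderiv_at_roots:
  "\<exists>n. (\<Prod>x\<leftarrow>xs. poly (pderiv (\<Prod>x\<leftarrow>xs. [:- x, 1:])) x) = (-1) ^ n * root_diff_prod xs"
proof (induction xs)
  case Nil
  then show ?case by (auto simp: root_diff_prod_def intro: exI[of _ 0])
next
  case (Cons x xs)
  let ?p = "\<Prod>x\<leftarrow>xs. [:- x, 1:]"
  obtain n where n: "(\<Prod>x\<leftarrow>xs. poly (pderiv ?p) x) = (-1) ^ n * root_diff_prod xs"
    using Cons by auto
  have root: "poly ?p y = 0" if "y \<in> set xs" for y
    using that by (simp add: poly_prod_list o_def prod_list_zero_iff image_iff)
  \<comment> \<open>At \<open>x\<close> only the first summand survives, at a root \<open>y\<close>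
    of \<open>?p\<close> only the second, which gives the extra factor \<open>y - x\<close>.\<close>
  have pd: "pderiv ([:- x, 1:] * ?p) = ?p + [:- x, 1:] * pderiv ?p"
    by (simp add: pderiv_mult pderiv_pCons del: mult_pCons_left)
  have "(\<Prod>y\<leftarrow>x # xs. poly (pderiv (\<Prod>x\<leftarrow>x # xs. [:- x, 1:])) y) =
        poly ?p x * (\<Prod>y\<leftarrow>xs. (y - x) * poly (pderiv ?p) y)"
    unfolding list.map prod_list.Cons pd
    by (intro arg_cong2[of _ _ _ _ "(*)"] arg_cong[of _ _ prod_list] map_cong)
       (auto simp: root algebra_simps)
  also have "poly ?p x = (\<Prod>y\<leftarrow>xs. x - y)"
    by (simp add: poly_prod_list o_def)
  also have "(\<Prod>y\<leftarrow>xs. x - y) * (\<Prod>y\<leftarrow>xs. (y - x) * poly (pderiv ?p) y)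
      = (\<Prod>y\<leftarrow>xs. (x - y) * ((y - x) * poly (pderiv ?p) y))"
    by (rule prod_list_mult_distrib[symmetric])
  also have "\<dots> = (\<Prod>y\<leftarrow>xs. ((-1) * (x - y)\<^sup>2) * poly (pderiv ?p) y)"
    by (intro arg_cong[of _ _ prod_list] map_cong) (auto simp: power2_eq_square algebra_simps)
  also have "\<dots> = (-1) ^ (length xs + n) * root_diff_prod (x # xs)"
    unfolding n root_diff_prod_Cons prod_list_mult_distrib
    by (simp add: map_replicate_const prod_list_replicate power_add)
  finally show ?case by blast
qed

section \<open>The minimal polynomial of \<open>\<zeta>\<close>: divisibility and simple
  roots\<close>

lemma
  assumes "is_pisot_poly P \<zeta>"
  shows pisot_poly_monic: "lead_coeff P = 1"
    and pisot_poly_root: "poly (of_int_poly P) \<zeta> = 0"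
    and pisot_poly_degree_pos: "degree P > 0"
proof -
  have *: "map_poly of_rat (of_int_poly P) = (of_int_poly P :: real poly)"
    by (simp add: map_poly_map_poly o_def)
  show 1: "lead_coeff P = 1" and 2: "poly (of_int_poly P) \<zeta> = 0"
    using assms unfolding is_pisot_poly_def is_min_poly_def * by auto
  show "degree P > 0"
  proof (rule ccontr)
    assume "\<not> degree P > 0"
    then have "P = [:1:]" using 1 by (auto elim!: degree_eq_zeroE)
    then show False using 2 by simp
  qed
qed

lemma pisot_poly_minimal:
  fixes g :: "rat poly"
  assumes "is_pisot_poly P \<zeta>" "g \<noteq> 0" "poly (map_poly of_rat g) \<zeta> = 0"
  shows "degree P \<le> degree g"
  using assms unfolding is_pisot_poly_def is_min_poly_def by auto

lemma pisot_poly_minimal_int: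
  fixes F :: "int poly"
  assumes "is_pisot_poly P \<zeta>" "F \<noteq> 0" "poly (of_int_poly F) \<zeta> = 0"
  shows "degree P \<le> degree F"
proof -
  have "map_poly of_rat (of_int_poly F) = (of_int_poly F :: real poly)"
    by (simp add: map_poly_map_poly o_def)
  then show ?thesis
    using pisot_poly_minimal[OF assms(1), of "of_int_poly F"] assms by simp
qed

text \<open>As \<open>P\<close> is monic, the remainder of \<open>F\<close> is integral and of
  smaller degree; if it vanishes at \<open>\<zeta>\<close>, minimality makes it zero.\<close>

lemma pisot_poly_dvd_iff:
  fixes F :: "int poly"
  assumes "is_pisot_poly P \<zeta>"
  shows "P dvd F \<longleftrightarrow> poly (of_int_poly F) \<zeta> = 0"
proof
  assume "P dvd F"
  then show "poly (of_int_poly F) \<zeta> = 0"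
    using pisot_poly_root[OF assms] by (auto simp: hom_distribs elim!: dvdE)
next
  assume F: "poly (of_int_poly F) \<zeta> = 0"
  obtain Q R where QR: "F = P * Q + R" "degree R < degree P"
    using monic_division[OF pisot_poly_monic pisot_poly_degree_pos] assms by metis
  then have "poly (of_int_poly R) \<zeta> = 0"
    using F pisot_poly_root[OF assms] by (simp add: hom_distribs)
  then have "R = 0" using pisot_poly_minimal_int[OF assms, of R] QR(2) by (meson not_less)
  then show "P dvd F" using QR by simp
qed

lemma map_poly_of_rat_mult:
  "map_poly (of_rat :: rat \<Rightarrow> 'a::field_char_0) (p * q) = map_poly of_rat p * map_poly of_rat q"
proof -
  interpret map_poly_idom_hom "of_rat :: rat \<Rightarrow> 'a" ..
  show ?thesis by (rule hom_mult)
qed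

text \<open>Minimality is available at \<open>\<zeta>\<close> only, while a multiple root
  \<open>z\<close> could be any complex number. A nonzero rational \<open>g\<close> of least degree
  vanishing at \<open>z\<close> divides both \<open>P\<close> and its derivative. It cannot vanish
  at \<open>\<zeta>\<close>, since the derivative has too small a degree. So the cofactor
  \<open>h\<close> of \<open>g\<close> in \<open>P\<close> vanishes there and has full degree, which
  makes \<open>g\<close> constant.\<close>

lemma pisot_poly_rsquarefree:
  assumes P: "is_pisot_poly P \<zeta>"
  shows "rsquarefree (of_int_poly P :: complex poly)"
  unfolding rsquarefree_roots
proof (rule allI, rule notI)
  fix z :: complex
  assume z: "poly (of_int_poly P) z = 0 \<and> poly (pderiv (of_int_poly P)) z = 0"
  let ?p = "of_int_poly P :: rat poly"
  let ?r = "map_poly of_rat :: rat poly \<Rightarrow> real poly"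
  let ?c = "map_poly of_rat :: rat poly \<Rightarrow> complex poly"
  have rP: "?r ?p = of_int_poly P" and cP: "?c ?p = of_int_poly P"
    by (simp_all add: map_poly_map_poly o_def)
  have p0: "?p \<noteq> 0" using pisot_poly_degree_pos[OF P] by auto
  have p'0: "pderiv ?p \<noteq> 0"
    using pisot_poly_degree_pos[OF P] by (simp add: pderiv_eq_0_iff)
  obtain g where g: "g \<noteq> 0 \<and> poly (?c g) z = 0"
    and min: "\<And>f. degree f < degree g \<Longrightarrow> \<not> (f \<noteq> 0 \<and> poly (?c f) z = 0)"
    using exists_least_iff[of "\<lambda>n. \<exists>g. (g \<noteq> 0 \<and> poly (?c g) z = 0) \<and> degree g = n"] p0 z cP by metis
  have dvd: "g dvd f" if "poly (?c f) z = 0" for f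
  proof -
    have "?c (g * (f div g) + f mod g) = ?c g * ?c (f div g) + ?c (f mod g)"
      by (simp only: of_rat_hom.map_poly_hom_add map_poly_of_rat_mult)
    then have "?c f = ?c g * ?c (f div g) + ?c (f mod g)" by simp
    then have "poly (?c f) z = poly (?c g) z * poly (?c (f div g)) z + poly (?c (f mod g)) z"
      by (metis poly_add poly_mult)
    then have "poly (?c (f mod g)) z = 0" using that g by simp
    then have "f mod g = 0" using min degree_mod_less[of g f] g by blast
    then show ?thesis by (simp add: mod_eq_0_iff_dvd)
  qed
  obtain h where h: "?p = g * h" using dvd[of ?p] z cP by (auto elim: dvdE)
  have "poly (?c (pderiv ?p)) z = 0" using z cP by (simp add: of_rat_hom.map_poly_pderiv)
  then obtain h' where h': "pderiv ?p = g * h'" using dvd by (metis dvdE)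
  have "poly (?r g) \<zeta> \<noteq> 0"
  proof
    assume "poly (?r g) \<zeta> = 0"
    then have "poly (?r (pderiv ?p)) \<zeta> = 0" unfolding h' by (simp add: map_poly_of_rat_mult)
    then have "degree P \<le> degree (pderiv ?p)" by (intro pisot_poly_minimal[OF P p'0])
    then show False using pisot_poly_degree_pos[OF P] by (simp add: degree_pderiv)
  qed
  moreover have "poly (?r g) \<zeta> * poly (?r h) \<zeta> = poly (?r ?p) \<zeta>"
    unfolding h by (simp add: map_poly_of_rat_mult)
  ultimately have "poly (?r h) \<zeta> = 0" using pisot_poly_root[OF P] rP by simp
  moreover have gh: "g \<noteq> 0" "h \<noteq> 0" using p0 h by auto
  ultimately have "degree P \<le> degree h" using pisot_poly_minimal[OF P] by blast
  moreover have "degree P = degree g + degree h"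
    using arg_cong[OF h, of degree] gh by (simp add: degree_mult_eq)
  ultimately have "degree g = 0" by simp
  then show False using g by (auto elim!: degree_eq_zeroE)
qed

lemma pisot_poly_roots:
  assumes P: "is_pisot_poly P \<zeta>"
  obtains xs :: "complex list"
  where "of_int_poly P = (\<Prod>x\<leftarrow>xs. [:- x, 1:])" "distinct xs" 
proof -
  let ?p = "of_int_poly P :: complex poly"
  have p0: "?p \<noteq> 0" using pisot_poly_degree_pos[OF P] by auto
  obtain xs where xs: "mset xs = proots ?p" using ex_mset by blast
  have "?p = (\<Prod>x\<in>#proots ?p. [:- x, 1:])"
    using complex_poly_decompose_multiset[of ?p] pisot_poly_monic[OF P] by simp
  also have "\<dots> = (\<Prod>x\<leftarrow>xs. [:- x, 1:])" by (metis xs mset_map prod_mset_prod_list)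
  finally have eq: "?p = (\<Prod>x\<leftarrow>xs. [:- x, 1:])" .
  have "count (mset xs) a \<le> 1" for a
    using pisot_poly_rsquarefree[OF P] p0 unfolding xs rsquarefree_def
    by (metis One_nat_def count_proots le_eq_less_or_eq zero_le_one)
  then have "distinct xs" 
    by (metis distinct_count_atmost_1 count_greater_zero_iff count_eq_zero_iff le_antisym less_one not_less in_multiset_in_set)
  with eq show ?thesis by (rule that)
qed

section \<open>Reduced forms and the ring \<open>int_adjoin \<zeta>\<close>\<close>

lemma has_denominator_exists:
  fixes r :: "nat \<Rightarrow> int" and C :: int
  assumes "C \<noteq> 0"
  shows "\<exists>N. has_denominator \<zeta> k ((\<Sum>j<k. of_int (r j) * \<zeta> ^ j) / of_int C) N"
proof -
  define g where "g = Gcd (insert C (r ` {..<k}))"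
  have gC: "g dvd C" and gr: "\<And>j. j < k \<Longrightarrow> g dvd r j"
    unfolding g_def by (intro Gcd_dvd; simp)+
  have "g \<noteq> 0" using gC assms by auto
  moreover have "g \<ge> 0" by (simp add: g_def)
  ultimately have g: "g > 0" by simp
  \<comment> \<open>\<open>C\<close> may be negative while a denominator is a natural number, so the
    sign of \<open>C\<close> moves into the numerators \<open>r'\<close>.\<close>
  define N where "N = nat (\<bar>C\<bar> div g)"
  define r' where "r' j = sgn C * (r j div g)" for j
  have "\<bar>C\<bar> div g > 0" using g gC assms by (simp add: pos_imp_zdiv_pos_iff zdvd_imp_le)
  then have N: "N \<ge> 1" "int N = \<bar>C\<bar> div g" by (auto simp: N_def)
  have CN: "C = sgn C * g * int N" using gC N by (metis abs_dvd_iff dvd_abs_iff dvd_mult_div_cancel mult.assoc sgn_mult_abs)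
  have rr: "r j = sgn C * g * r' j" if "j < k" for j
    using gr[OF that] assms by (auto simp: r'_def sgn_if)
  have "Gcd (insert (int N) (r' ` {..<k})) = 1" (is "?G = 1")
  proof -
    have G: "?G dvd int N" "\<And>j. j < k \<Longrightarrow> ?G dvd r' j" by (intro Gcd_dvd; simp)+
    \<comment> \<open>A common divisor left after cancelling \<open>g\<close> would make
      \<open>g * ?G\<close> divide \<open>g\<close>, the gcd before cancelling.\<close>
    have "g * ?G dvd C"
      by (subst CN, unfold mult.assoc) (intro dvd_mult mult_dvd_mono dvd_refl G)
    moreover have "g * ?G dvd r j" if "j < k" for j
      by (subst rr[OF that], unfold mult.assoc) (intro dvd_mult mult_dvd_mono dvd_refl G that)
    ultimately have "g * ?G dvd Gcd (insert C (r ` {..<k}))" by (intro Gcd_greatest) auto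
    then have "g * ?G dvd g" by (fold g_def)
    then have "?G dvd 1" using g by simp
    moreover have "?G \<ge> 0" by simp
    ultimately show ?thesis by simp
  qed
  moreover have "(\<Sum>j<k. of_int (r j) * \<zeta> ^ j) / of_int C = (\<Sum>j<k. of_int (r' j) * \<zeta> ^ j) / of_nat N"
  proof -
    have "(\<Sum>j<k. of_int (r j) * \<zeta> ^ j) = of_int (sgn C * g) * (\<Sum>j<k. of_int (r' j) * \<zeta> ^ j)"
      by (subst sum_distrib_left, intro sum.cong) (auto simp: rr)
    moreover have "real_of_int C = of_int (sgn C * g) * of_nat N"
      by (subst CN) simp
    moreover have "real_of_int (sgn C * g) \<noteq> 0" using g assms by (auto simp: sgn_if)
    ultimately show ?thesis by simp
  qed
  ultimately show ?thesis using N unfolding has_denominator_def by blast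
qed

lemma
  shows int_adjoin_of_int: "of_int c \<in> int_adjoin \<zeta>"
    and int_adjoin_self: "\<zeta> \<in> int_adjoin \<zeta>"
    and int_adjoin_add: "a \<in> int_adjoin \<zeta> \<Longrightarrow> b \<in> int_adjoin \<zeta> \<Longrightarrow> a + b \<in> int_adjoin \<zeta>"
    and int_adjoin_mult: "a \<in> int_adjoin \<zeta> \<Longrightarrow> b \<in> int_adjoin \<zeta> \<Longrightarrow> a * b \<in> int_adjoin \<zeta>"
proof -
  show "of_int c \<in> int_adjoin \<zeta>"
    unfolding int_adjoin_def by (rule range_eqI[of _ _ "[:c:]"]) (simp add: hom_distribs)
  show "\<zeta> \<in> int_adjoin \<zeta>"
    unfolding int_adjoin_def by (rule range_eqI[of _ _ "[:0, 1:]"]) (simp add: hom_distribs)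
  assume "a \<in> int_adjoin \<zeta>" "b \<in> int_adjoin \<zeta>"
  then obtain f g :: "int poly" where fg: "a = poly (of_int_poly f) \<zeta>" "b = poly (of_int_poly g) \<zeta>"
    unfolding int_adjoin_def by blast
  show "a + b \<in> int_adjoin \<zeta>"
    unfolding int_adjoin_def fg by (rule range_eqI[of _ _ "f + g"]) (simp add: hom_distribs)
  show "a * b \<in> int_adjoin \<zeta>"
    unfolding int_adjoin_def fg by (rule range_eqI[of _ _ "f * g"]) (simp add: hom_distribs)
qed

lemma int_adjoin_sum:
  "(\<And>i. i \<in> I \<Longrightarrow> f i \<in> int_adjoin \<zeta>) \<Longrightarrow> sum f I \<in> int_adjoin \<zeta>"
  using int_adjoin_of_int[of 0 \<zeta>]
  by (induction I rule: infinite_finite_induct) (auto intro: int_adjoin_add)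

section \<open>Dividing \<open>P\<close> by \<open>X - \<zeta>\<close>, and integrality for elements
  of \<open>M_set \<zeta>\<close>\<close>

lemma poly_pderiv_linear_factor:
  fixes p :: "'a::idom poly"
  assumes "p = [:- x, 1:] * q"
  shows "poly (pderiv p) x = poly q x"
  unfolding assms by (simp add: pderiv_mult pderiv_pCons del: mult_pCons_left)

text \<open>Comparing coefficients in \<open>P = (X - \<zeta>) Q\<close> expresses each coefficient
  of \<open>Q\<close> by the next higher one, \<open>\<zeta>\<close> and an integer. The induction
  therefore descends from the top, with \<open>i\<close> the distance from the degree.\<close>

lemma coeff_synthetic_div_in_int_adjoin:
  fixes P :: "int poly"
  assumes "poly (of_int_poly P) \<zeta> = 0"
  shows "coeff (synthetic_div (of_int_poly P) \<zeta>) j \<in> int_adjoin \<zeta>"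
proof -
  define Q where "Q = synthetic_div (of_int_poly P) \<zeta>"
  have PQ: "of_int_poly P = [:- \<zeta>, 1:] * Q"
    using synthetic_div_correct'[of \<zeta> "of_int_poly P"] assms by (simp add: Q_def del: mult_pCons_left)
  have step: "coeff Q j = of_int (coeff P (Suc j)) + \<zeta> * coeff Q (Suc j)" for j
    using arg_cong[OF PQ, of "\<lambda>p. coeff p (Suc j)"] by simp
  have "coeff Q (degree Q - i) \<in> int_adjoin \<zeta>" if "i \<le> degree Q" for i
    using that
  proof (induction i)
    case 0
    show ?case using step[of "degree Q"] int_adjoin_of_int by (simp add: coeff_eq_0)
  next
    case (Suc i)
    then have "Suc (degree Q - Suc i) = degree Q - i" by simp
    then show ?case
      using step[of "degree Q - Suc i"] Suc
      by (auto intro!: int_adjoin_add int_adjoin_mult int_adjoin_of_int int_adjoin_self)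
  qed
  from this[of "degree Q - j"] have "j \<le> degree Q \<Longrightarrow> coeff Q j \<in> int_adjoin \<zeta>" by simp
  moreover have "coeff Q j \<in> int_adjoin \<zeta>" if "j > degree Q"
    using that int_adjoin_of_int[of 0] by (simp add: coeff_eq_0)
  ultimately show ?thesis unfolding Q_def by linarith
qed

text \<open>With \<open>a n\<close> the integer nearest to \<open>\<alpha> \<zeta>\<^sup>n\<close>, the integer sequence obtained by applying the recurrence \<open>P\<close>
  to \<open>a\<close> tends to 0, hence vanishes eventually. Applying only \<open>Q = P / (X - \<zeta>)\<close> therefore leaves
  a sequence \<open>s\<close> in \<open>\<int>[\<zeta>]\<close> that is eventually geometric with ratio \<open>\<zeta>\<close> and close to \<open>\<alpha> \<zeta>\<^sup>n Q(\<zeta>)\<close>,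
  so it is equal to it.\<close>

lemma M_set_mult_pderiv_in_int_adjoin:
  assumes root: "poly (of_int_poly P) \<zeta> = 0" and deg: "degree P > 0" and "1 < \<zeta>" and \<alpha>: "\<alpha> \<in> M_set \<zeta>"
  obtains m where "\<alpha> * \<zeta> ^ m * poly (of_int_poly (pderiv P)) \<zeta> \<in> int_adjoin \<zeta>"
proof -
  define k where "k = degree P"
  define a where "a n = round (\<alpha> * \<zeta> ^ n)" for n
  define e where "e n = \<alpha> * \<zeta> ^ n - of_int (a n)" for n
  define Q where "Q = synthetic_div (of_int_poly P) \<zeta>"
  define c where "c n = (\<Sum>j\<le>k. coeff P j * a (n + j))" for n
  define s where "s n = (\<Sum>j<k. coeff Q j * of_int (a (n + j)))" for n
  have e: "e \<longlonglongrightarrow> 0"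
    using \<alpha> by - (rule tendsto_rabs_zero_cancel, simp add: M_set_def nearest_int_dist_def e_def a_def)
  have e_lin: "(\<lambda>n. \<Sum>j\<in>J. b j * e (n + j)) \<longlonglongrightarrow> 0" for b :: "nat \<Rightarrow> real" and J
    using LIMSEQ_ignore_initial_segment[OF e] by (intro tendsto_null_sum tendsto_mult_right_zero) auto
  have ae: "of_int (a n) = \<alpha> * \<zeta> ^ n - e n" for n by (simp add: e_def)
  have PQ: "of_int_poly P = [:- \<zeta>, 1:] * Q"
    using synthetic_div_correct'[of \<zeta> "of_int_poly P"] root by (simp add: Q_def del: mult_pCons_left)
  have Q': "poly (of_int_poly (pderiv P)) \<zeta> = poly Q \<zeta>"
    using poly_pderiv_linear_factor[OF PQ] by (simp add: of_int_hom.map_poly_pderiv)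
  have degQ: "degree Q = k - 1" by (simp add: Q_def k_def degree_synthetic_div)
  then have "degree Q < k" using deg by (simp add: k_def)
  then have Qk: "coeff Q k = 0" by (rule coeff_eq_0)
  have p0: "real_of_int (coeff P 0) = - \<zeta> * coeff Q 0"
    using arg_cong[OF PQ, of "\<lambda>p. coeff p 0"] by simp
  have pS: "real_of_int (coeff P (Suc j)) = coeff Q j - \<zeta> * coeff Q (Suc j)" for j
    using arg_cong[OF PQ, of "\<lambda>p. coeff p (Suc j)"] by simp
  have pow: "(\<Sum>j\<le>k. of_int (coeff P j) * \<zeta> ^ j) = 0"
    using root by (simp add: poly_altdef k_def)
  \<comment> \<open>The main terms \<open>\<alpha> * \<zeta> ^ (n + j)\<close> cancel because
    \<open>\<zeta>\<close> is a root of \<open>P\<close>; only the rounding errors remain.\<close>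
  have c_eq: "of_int (c n) = - (\<Sum>j\<le>k. of_int (coeff P j) * e (n + j))" for n
  proof -
    have "real_of_int (c n) = \<alpha> * \<zeta> ^ n * (\<Sum>j\<le>k. of_int (coeff P j) * \<zeta> ^ j) - (\<Sum>j\<le>k. of_int (coeff P j) * e (n + j))"
      by (simp add: c_def ae sum_distrib_left power_add right_diff_distrib sum_subtractf mult_ac)
    then show ?thesis by (simp add: pow)
  qed
  have "(\<lambda>n. real_of_int (c n)) \<longlonglongrightarrow> 0"
    unfolding c_eq using tendsto_minus[OF e_lin] by simp
  then have "(\<lambda>n. \<bar>real_of_int (c n)\<bar>) \<longlonglongrightarrow> 0" by (rule tendsto_rabs_zero)
  then have "\<forall>\<^sub>F n in sequentially. \<bar>real_of_int (c n)\<bar> < 1" by (rule order_tendstoD(2)) simp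
  then obtain n0 where n0: "\<And>n. n \<ge> n0 \<Longrightarrow> c n = 0"
    unfolding eventually_sequentially by (metis of_int_abs of_int_less_1_iff zabs_less_one_iff)
  \<comment> \<open>Since \<open>P = (X - \<zeta>) Q\<close>, the vanishing \<open>c n\<close>
    equals \<open>s (Suc n) - \<zeta> * s n\<close>. The shifted sum reaches index \<open>k\<close>,
    where the coefficient of \<open>Q\<close> is 0.\<close>
  have s_Suc: "s (Suc n) = \<zeta> * s n" if "n \<ge> n0" for n
  proof -
    have "0 = (\<Sum>j\<le>k. real_of_int (coeff P j) * of_int (a (n + j)))"
      using n0[OF that] by (simp add: c_def flip: of_int_mult of_int_sum)
    also have "\<dots> = of_int (coeff P 0) * of_int (a n) + (\<Sum>j<k. of_int (coeff P (Suc j)) * of_int (a (Suc n + j)))"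
      unfolding lessThan_Suc_atMost[symmetric] by (subst sum.lessThan_Suc_shift) simp
    also have "\<dots> = s (Suc n) - \<zeta> * (coeff Q 0 * of_int (a n) + (\<Sum>j<k. coeff Q (Suc j) * of_int (a (Suc n + j))))"
      unfolding p0 pS s_def by (simp add: algebra_simps sum_subtractf sum_distrib_left)
    also have "coeff Q 0 * of_int (a n) + (\<Sum>j<k. coeff Q (Suc j) * of_int (a (Suc n + j)))
      = (\<Sum>j<Suc k. coeff Q j * of_int (a (n + j)))"
      by (subst sum.lessThan_Suc_shift) simp
    also have "\<dots> = s n" using Qk by (simp add: s_def)
    finally show ?thesis by simp
  qed
  define d where "d n = s n - \<alpha> * \<zeta> ^ n * poly Q \<zeta>" for n
  have d_eq: "d n = - (\<Sum>j<k. coeff Q j * e (n + j))" for n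
    by (simp add: d_def s_def poly_eq_sum_lessThan[OF \<open>degree Q < k\<close>] ae sum_distrib_left power_add
        right_diff_distrib sum_subtractf mult_ac)
  have "(\<lambda>n. d n) \<longlonglongrightarrow> 0" unfolding d_eq using tendsto_minus[OF e_lin] by simp
  then have d: "d \<longlonglongrightarrow> 0" .
  have "d (Suc n) = \<zeta> * d n" if "n \<ge> n0" for n
    by (simp add: d_def s_Suc[OF that] algebra_simps)
  then have d_geo: "d (m + n0) = \<zeta> ^ m * d n0" for m
    by (induction m) simp_all
  \<comment> \<open>The deviation \<open>d\<close> tends to 0, yet from \<open>n0\<close> on each
    step multiplies it by \<open>\<zeta> > 1\<close>. Hence it is already 0 at
    \<open>n0\<close>.\<close>
  have "\<bar>d n0\<bar> \<le> \<bar>d (m + n0)\<bar>" for m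
    using \<open>1 < \<zeta>\<close> mult_right_mono[of 1 "\<zeta> ^ m" "\<bar>d n0\<bar>"] by (simp add: d_geo abs_mult)
  moreover have "(\<lambda>m. \<bar>d (m + n0)\<bar>) \<longlonglongrightarrow> 0"
    using LIMSEQ_ignore_initial_segment[OF d] by (rule tendsto_rabs_zero)
  ultimately have "\<bar>d n0\<bar> \<le> 0" by (intro LIMSEQ_le_const) auto
  then have "\<alpha> * \<zeta> ^ n0 * poly (of_int_poly (pderiv P)) \<zeta> = s n0" by (simp add: d_def Q')
  moreover have "s n0 \<in> int_adjoin \<zeta>"
    unfolding s_def Q_def
    by (intro int_adjoin_sum int_adjoin_mult int_adjoin_of_int coeff_synthetic_div_in_int_adjoin root)
  ultimately show ?thesis using that[of n0] by simp
qed

section \<open>An explicit element of \<open>M_set \<zeta>\<close> by Lagrange interpolation\<close>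

lemma nearest_int_dist_le: "nearest_int_dist x \<le> \<bar>x - of_int m\<bar>"
  unfolding nearest_int_dist_def by (rule round_diff_minimal)

lemma nearest_int_dist_nonneg: "0 \<le> nearest_int_dist x"
  unfolding nearest_int_dist_def by simp

text \<open>\<open>R\<close> is its own interpolation polynomial on \<open>S\<close>, and each
  product in the denominators is monic of degree \<open>card S - 1\<close>.\<close>

lemma lagrange_top_coeff:
  fixes R :: "'a::field poly"
  assumes S: "finite S" and R: "degree R < card S"
  shows "coeff R (card S - 1) = (\<Sum>x\<in>S. poly R x / poly (\<Prod>y\<in>S - {x}. [:- y, 1:]) x)"
proof -
  define L where "L x = (\<Prod>y\<in>S - {x}. [:- y, 1:])" for x
  define T where "T = (\<Sum>x\<in>S. Polynomial.smult (poly R x / poly (L x) x) (L x))"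
  have degL: "degree (L x) = card S - 1" if "x \<in> S" for x
    using that S by (simp add: L_def degree_prod_sum_eq)
  have "coeff (L x) (card S - 1) = 1" if "x \<in> S" for x
    using monic_prod[of "S - {x}" "\<lambda>y. [:- y, 1:]"] degL[OF that] by (simp add: L_def)
  then have "coeff T (card S - 1) = (\<Sum>x\<in>S. poly R x / poly (L x) x)"
    by (simp add: T_def coeff_sum)
  moreover have "T = R"
  proof (rule poly_eqI_degree[of S])
    fix z assume z: "z \<in> S"
    have "poly (L x) z = 0" if "x \<noteq> z" for x
      using that z S by (auto simp: L_def poly_prod)
    then have "poly T z = (\<Sum>x\<in>S. if x = z then poly R x / poly (L x) x * poly (L x) z else 0)"
      unfolding T_def poly_sum by (intro sum.cong) auto
    also have "\<dots> = poly R z / poly (L z) z * poly (L z) z" using S z by simp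
    finally show "poly T z = poly R z" using S by (auto simp: L_def poly_prod)
  next
    show "degree T < card S" unfolding T_def
      using R degL by (intro degree_sum_less) (auto intro!: le_less_trans[OF degree_smult_le])
  qed (use R in auto)
  ultimately show ?thesis by (simp add: L_def)
qed

text \<open>By Lagrange interpolation the top coefficient of \<open>X\<^sup>n mod P\<close>, an integer, is the
  sum of \<open>x\<^sup>n / P'(x)\<close> over the roots \<open>x\<close> of \<open>P\<close>, and only the term of \<open>\<zeta>\<close> does not tend to 0.\<close>

lemma inverse_pderiv_in_M_set:
  assumes \<zeta>: "pisot \<zeta>" and P: "is_pisot_poly P \<zeta>"
  shows "1 / (\<zeta> * poly (of_int_poly (pderiv P)) \<zeta>) \<in> M_set \<zeta>"
proof -
  obtain xs :: "complex list"
    where xs: "of_int_poly P = (\<Prod>x\<leftarrow>xs. [:- x, 1:])" "distinct xs"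
    using pisot_poly_roots[OF P] .
  define S where "S = set xs"
  define k where "k = degree P"
  have PS: "of_int_poly P = (\<Prod>x\<in>S. [:- x, 1:])"
    unfolding S_def xs(1) by (rule prod.distinct_set_conv_list[symmetric, OF xs(2)])
  have S: "finite S" "card S = k"
    using arg_cong[OF PS, of degree] by (simp_all add: S_def k_def degree_prod_sum_eq)
  have root_iff: "x \<in> S \<longleftrightarrow> poly (of_int_poly P) x = 0" for x
    unfolding PS poly_prod using S by auto
  \<comment> \<open>For \<open>x\<close> in \<open>S\<close> this is \<open>1 / P'(x)\<close>; the
    identification with the derivative is made only at \<open>\<zeta>\<close>.\<close>
  define c where "c x = 1 / poly (\<Prod>y\<in>S - {x}. [:- y, 1:]) x" for x
  have "poly (of_int_poly P) (complex_of_real \<zeta>) = of_real (poly (of_int_poly P) \<zeta>)"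
    by (simp add: poly_altdef)
  then have \<zeta>S: "of_real \<zeta> \<in> S" using pisot_poly_root[OF P] by (simp add: root_iff)
  have "of_int_poly P = [:- of_real \<zeta>, 1:] * (\<Prod>y\<in>S - {of_real \<zeta>}. [:- y, 1:])"
    unfolding PS by (rule prod.remove[OF S(1) \<zeta>S])
  from poly_pderiv_linear_factor[OF this]
  have "poly (of_int_poly (pderiv P)) (complex_of_real \<zeta>) = poly (\<Prod>y\<in>S - {of_real \<zeta>}. [:- y, 1:]) (of_real \<zeta>)"
    by (simp add: of_int_hom.map_poly_pderiv)
  moreover have "poly (of_int_poly (pderiv P)) (complex_of_real \<zeta>) = of_real (poly (of_int_poly (pderiv P)) \<zeta>)"
    by (simp add: poly_altdef)
  ultimately have c\<zeta>: "c (of_real \<zeta>) = of_real (1 / poly (of_int_poly (pderiv P)) \<zeta>)"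
    by (simp add: c_def)
  have small: "norm x < 1" if "x \<in> S - {of_real \<zeta>}" for x
  proof -
    have "map_poly of_rat (of_int_poly P) = (of_int_poly P :: complex poly)"
      by (simp add: map_poly_map_poly o_def)
    then have "x \<in> conjugates \<zeta>"
      using that P root_iff[of x] unfolding conjugates_def is_pisot_poly_def by auto
    then show ?thesis using \<zeta> that unfolding pisot_def by blast
  qed
  have "\<exists>u::int. of_int u = (\<Sum>x\<in>S. c x * x ^ n)" for n
  proof -
    obtain Q R where QR: "monom 1 n = P * Q + R" "degree R < degree P"
      using monic_division[OF pisot_poly_monic[OF P] pisot_poly_degree_pos[OF P]] .
    have "poly (of_int_poly R) x = x ^ n" if "x \<in> S" for x
    proof -
      have "poly (of_int_poly (monom 1 n)) x = poly (of_int_poly R) x"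
        unfolding QR(1) using that by (simp add: hom_distribs root_iff)
      then show ?thesis by (simp add: poly_monom)
    qed
    then have "of_int (coeff R (k - 1)) = (\<Sum>x\<in>S. c x * x ^ n)"
      using lagrange_top_coeff[OF S(1), of "of_int_poly R"] QR(2) S(2)
      by (simp add: c_def k_def)
    then show ?thesis ..
  qed
  then obtain u :: "nat \<Rightarrow> int" where u: "\<And>n. of_int (u n) = (\<Sum>x\<in>S. c x * x ^ n)" by metis
  define \<beta> where "\<beta> = 1 / poly (of_int_poly (pderiv P)) \<zeta>"
  have "(\<lambda>n. \<Sum>x\<in>S - {of_real \<zeta>}. c x * x ^ n) \<longlonglongrightarrow> 0"
    using small by (intro tendsto_null_sum tendsto_mult_right_zero LIMSEQ_power_zero)
  moreover have "(\<Sum>x\<in>S - {of_real \<zeta>}. c x * x ^ n) = complex_of_real (of_int (u n) - \<beta> * \<zeta> ^ n)" for n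
    using u[of n] by (simp add: sum.remove[OF S(1) \<zeta>S] c\<zeta> \<beta>_def)
  ultimately have "(\<lambda>n. complex_of_real (of_int (u n) - \<beta> * \<zeta> ^ n)) \<longlonglongrightarrow> of_real 0" by simp
  then have "(\<lambda>n. of_int (u n) - \<beta> * \<zeta> ^ n) \<longlonglongrightarrow> 0" by (subst (asm) tendsto_of_real_iff)
  then have lim: "(\<lambda>n. \<bar>\<beta> * \<zeta> ^ n - of_int (u n)\<bar>) \<longlonglongrightarrow> 0"
    using tendsto_rabs_zero by (fastforce simp: abs_minus_commute)
  have "(\<lambda>n. nearest_int_dist (\<beta> * \<zeta> ^ n)) \<longlonglongrightarrow> 0"
    by (rule tendsto_sandwich[OF _ _ tendsto_const lim])
       (auto intro!: always_eventually nearest_int_dist_le simp: nearest_int_dist_nonneg)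
  \<comment> \<open>The extra factor \<open>\<zeta>\<close> in the denominator merely shifts the
    sequence by one index, which does not affect the limit.\<close>
  moreover have "\<beta> * \<zeta> ^ n = 1 / (\<zeta> * poly (of_int_poly (pderiv P)) \<zeta>) * \<zeta> ^ Suc n" for n
    using \<zeta> by (simp add: \<beta>_def pisot_def)
  ultimately have "(\<lambda>n. nearest_int_dist (1 / (\<zeta> * poly (of_int_poly (pderiv P)) \<zeta>) * \<zeta> ^ Suc n)) \<longlonglongrightarrow> 0"
    by simp
  then show ?thesis unfolding M_set_def by (intro CollectI) (rule LIMSEQ_imp_Suc)
qed

section \<open>Norms as products over the roots, and their link to the discriminant\<close>

text \<open>Modulo \<open>P\<close> the product \<open>W * G\<close> is the constant
  \<open>c\<close>, so the values of \<open>W\<close> and \<open>G\<close> multiply to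
  \<open>c\<close> at each root; the product over all roots gives the claim.\<close>

lemma norm_mult_eq_power:
  fixes P W G :: "int poly" and xs :: "complex list"
  assumes P: "of_int_poly P = (\<Prod>x\<leftarrow>xs. [:- x, 1:])"
    and dvd: "P dvd W * G - [:c:]"
    and D: "of_int D = (\<Prod>x\<leftarrow>xs. poly (of_int_poly W) x)"
    and E: "of_int E = (\<Prod>x\<leftarrow>xs. poly (of_int_poly G) x)"
  shows "D * E = c ^ length xs"
proof -
  have "poly (of_int_poly W) x * poly (of_int_poly G) x = of_int c" if "x \<in> set xs" for x
  proof -
    obtain Q where Q: "W * G - [:c:] = P * Q" using dvd by (auto elim: dvdE)
    have "poly (of_int_poly P) x = 0"
      using that unfolding P by (simp add: poly_prod_list o_def prod_list_zero_iff image_iff)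
    then have "poly (of_int_poly (W * G - [:c:])) x = 0" unfolding Q by (simp add: hom_distribs)
    then show ?thesis by (simp add: hom_distribs)
  qed
  then have "(\<Prod>x\<leftarrow>xs. poly (of_int_poly W) x * poly (of_int_poly G) x) = (\<Prod>x\<leftarrow>xs. of_int c)"
    by (intro arg_cong[of _ _ prod_list] map_cong) auto
  then have "complex_of_int (D * E) = of_int (c ^ length xs)"
    unfolding prod_list_mult_distrib of_int_mult D E by (simp add: map_replicate_const prod_list_replicate)
  then show ?thesis by (simp only: of_int_eq_iff)
qed

text \<open>Up to sign, the values of \<open>X\<close> at the roots multiply to \<open>P(0)\<close>
  and those of the derivative to the discriminant.\<close>

lemma norm_X_pderiv:
  fixes P :: "int poly" and xs :: "complex list"
  assumes P: "of_int_poly P = (\<Prod>x\<leftarrow>xs. [:- x, 1:])"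
  obtains n m where
    "(\<Prod>x\<leftarrow>xs. poly (of_int_poly (pderiv P)) x) = (-1) ^ n * discriminant (of_int_poly P)"
    "(\<Prod>x\<leftarrow>xs. poly (of_int_poly (pCons 0 (pderiv P))) x) =
       (-1) ^ m * (discriminant (of_int_poly P) * of_int (poly P 0))"
proof -
  obtain n where "(\<Prod>x\<leftarrow>xs. poly (pderiv (of_int_poly P)) x) = (-1) ^ n * discriminant (of_int_poly P)"
    using prod_pderiv_at_roots[of xs] unfolding P discriminant_eq by auto
  then have n: "(\<Prod>x\<leftarrow>xs. poly (of_int_poly (pderiv P)) x) = (-1) ^ n * discriminant (of_int_poly P)"
    by (simp add: of_int_hom.map_poly_pderiv)
  have "of_int (poly P 0) = poly (of_int_poly P) (0 :: complex)"
    by (simp add: poly_0_coeff_0)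
  also have "\<dots> = (\<Prod>x\<leftarrow>xs. (-1) * x)"
    unfolding P by (simp add: poly_prod_list o_def)
  also have "\<dots> = (-1) ^ length xs * prod_list xs"
    unfolding prod_list_mult_distrib by (simp add: map_replicate_const prod_list_replicate)
  finally have "prod_list xs = (-1) ^ length xs * of_int (poly P 0)" by simp
  moreover have "(\<Prod>x\<leftarrow>xs. poly (of_int_poly (pCons 0 (pderiv P))) x) =
      prod_list xs * (\<Prod>x\<leftarrow>xs. poly (of_int_poly (pderiv P)) x)"
    by (simp add: hom_distribs prod_list_mult_distrib)
  ultimately have "(\<Prod>x\<leftarrow>xs. poly (of_int_poly (pCons 0 (pderiv P))) x) =
      (-1) ^ (length xs + n) * (discriminant (of_int_poly P) * of_int (poly P 0))"
    unfolding n by (simp add: power_add)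
  with n show ?thesis by (rule that)
qed

text \<open>The discriminant is defined as a complex number. It is an integer because, up to sign,
  it is the norm of the derivative, and \<open>norm_exists\<close> provides that norm as an
  integer.\<close>

lemma norm_X_pderiv_dvd_iff:
  fixes P :: "int poly" and xs :: "complex list"
  assumes monic: "lead_coeff P = 1" and deg: "degree P > 0"
    and P: "of_int_poly P = (\<Prod>x\<leftarrow>xs. [:- x, 1:])" and dist: "distinct xs"
    and D: "of_int D = (\<Prod>x\<leftarrow>xs. poly (of_int_poly (pCons 0 (pderiv P))) x)"
  shows "q dvd D \<longleftrightarrow> (\<exists>E. of_int E = discriminant (of_int_poly P) \<and> q dvd E * poly P 0)"
proof -
  obtain n m where
    n: "(\<Prod>x\<leftarrow>xs. poly (of_int_poly (pderiv P)) x) = (-1) ^ n * discriminant (of_int_poly P)" and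
    m: "(\<Prod>x\<leftarrow>xs. poly (of_int_poly (pCons 0 (pderiv P))) x) =
       (-1) ^ m * (discriminant (of_int_poly P) * of_int (poly P 0))"
    using norm_X_pderiv[OF P] .
  obtain E0 :: int and A where "of_int E0 = (\<Prod>x\<leftarrow>xs. poly (of_int_poly (pderiv P)) x)"
    using norm_exists[OF monic deg P dist] .
  then have "of_int ((-1) ^ n * E0) = discriminant (of_int_poly P)"
    by (simp add: n)
  moreover have "q dvd D \<longleftrightarrow> q dvd E * poly P 0" if "of_int E = discriminant (of_int_poly P)" for E
  proof -
    have "complex_of_int D = of_int ((-1) ^ m * (E * poly P 0))"
      unfolding D m by (simp add: that)
    then have "D = (-1) ^ m * (E * poly P 0)" by (simp only: of_int_eq_iff)
    then show ?thesis by (cases "even m") simp_all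
  qed
  ultimately show ?thesis by blast
qed

text \<open>A factor \<open>X\<close> of \<open>P\<close> could be cancelled, leaving a polynomial
  of smaller degree that vanishes at \<open>\<zeta>\<close>.\<close>

lemma pisot_poly_const_nonzero:
  assumes P: "is_pisot_poly P \<zeta>" and "\<zeta> \<noteq> 0"
  shows "poly P 0 \<noteq> 0"
proof
  assume "poly P 0 = 0"
  then obtain F where F: "P = [:0, 1:] * F" by (auto simp: poly_eq_0_iff_dvd elim: dvdE)
  then have "F \<noteq> 0" using pisot_poly_degree_pos[OF P] by auto
  moreover have "poly (of_int_poly F) \<zeta> = 0"
    using pisot_poly_root[OF P] \<open>\<zeta> \<noteq> 0\<close> unfolding F by (simp add: hom_distribs)
  ultimately have "degree P \<le> degree F" by (intro pisot_poly_minimal_int[OF P])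
  then show False using F \<open>F \<noteq> 0\<close> by simp
qed

lemma poly_of_int_sum_monom:
  fixes \<zeta> :: "'a::comm_ring_1"
  shows "poly (of_int_poly (\<Sum>j<k. monom (r j) j)) \<zeta> = (\<Sum>j<k. of_int (r j) * \<zeta> ^ j)"
  by (simp add: hom_distribs poly_sum poly_monom)

section \<open>Comparing the primes in denominators with the primes in the norm
  \<open>D\<close>\<close>

theorem theorem3p9:
  fixes \<zeta> :: real and P :: "int poly" and k q :: nat
  assumes "pisot \<zeta>" and "is_pisot_poly P \<zeta>" and "k = degree P" and "prime q"
  shows "(\<exists>\<alpha> \<in> M_set \<zeta> - int_adjoin \<zeta>. \<exists>N. has_denominator \<zeta> k \<alpha> N \<and> q dvd N) \<longleftrightarrow>
         (\<exists>D :: int. of_int D = discriminant (map_poly of_int P) \<and> int q dvd D * poly P 0)"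
proof -
  note P = \<open>is_pisot_poly P \<zeta>\<close>
  note monic = pisot_poly_monic[OF P]
  note deg = pisot_poly_degree_pos[OF P]
  have \<zeta>: "1 < \<zeta>" using \<open>pisot \<zeta>\<close> by (simp add: pisot_def)
  have q: "prime (int q)" using \<open>prime q\<close> by simp
  obtain xs :: "complex list" where xs: "of_int_poly P = (\<Prod>x\<leftarrow>xs. [:- x, 1:])" and dist: "distinct xs"
    using pisot_poly_roots[OF P] .
  define W where "W = pCons 0 (pderiv P)"
  have W\<zeta>: "poly (of_int_poly W) \<zeta> = \<zeta> * poly (of_int_poly (pderiv P)) \<zeta>"
    by (simp add: W_def hom_distribs)
  obtain D A where D: "of_int D = (\<Prod>x\<leftarrow>xs. poly (of_int_poly W) x)" and A: "P dvd W * A - [:D:]"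
    using norm_exists[OF monic deg xs dist] .
  have WA: "poly (of_int_poly W) \<zeta> * poly (of_int_poly A) \<zeta> = of_int D"
    using A unfolding pisot_poly_dvd_iff[OF P] by (simp add: hom_distribs)
  have len: "length xs = k"
    using arg_cong[OF xs, of degree] \<open>k = degree P\<close> by (simp add: degree_linear_factors)
  have "(\<exists>\<alpha> \<in> M_set \<zeta> - int_adjoin \<zeta>. \<exists>N. has_denominator \<zeta> k \<alpha> N \<and> q dvd N) \<longleftrightarrow> int q dvd D"
  proof
    assume "\<exists>\<alpha> \<in> M_set \<zeta> - int_adjoin \<zeta>. \<exists>N. has_denominator \<zeta> k \<alpha> N \<and> q dvd N"
    then obtain \<alpha> N r where \<alpha>: "\<alpha> \<in> M_set \<zeta>" and qN: "q dvd N" and N: "N \<ge> 1"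
      and r: "\<alpha> = (\<Sum>j<k. of_int (r j) * \<zeta> ^ j) / of_nat N" "Gcd (insert (int N) (r ` {..<k})) = 1"
      unfolding has_denominator_def by blast
    define F where "F = (\<Sum>j<k. monom (r j) j)"
    obtain m where m: "\<alpha> * \<zeta> ^ m * poly (of_int_poly (pderiv P)) \<zeta> \<in> int_adjoin \<zeta>"
      using M_set_mult_pderiv_in_int_adjoin[OF pisot_poly_root[OF P] deg \<zeta> \<alpha>] .
    then obtain B where B: "\<alpha> * \<zeta> ^ m * poly (of_int_poly (pderiv P)) \<zeta> = poly (of_int_poly B) \<zeta>"
      unfolding int_adjoin_def by blast
    \<comment> \<open>\<open>B\<close> stands for \<open>\<alpha>\<close> times \<open>m\<close>
      factors \<open>\<zeta>\<close> and one factor \<open>P'(\<zeta>)\<close>. One more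
      \<open>\<zeta>\<close> and \<open>m\<close> more \<open>P'(\<zeta>)\<close> complete
      \<open>W(\<zeta>)\<close> to the power \<open>Suc m\<close>, which the power of
      \<open>A\<close> turns into a power of \<open>D\<close>.\<close>
    define H where "H = B * [:0, 1:] * pderiv P ^ m * A ^ Suc m"
    have "\<alpha> * of_int D ^ Suc m =
        (\<alpha> * \<zeta> ^ m * poly (of_int_poly (pderiv P)) \<zeta>) * \<zeta> * poly (of_int_poly (pderiv P)) \<zeta> ^ m * poly (of_int_poly A) \<zeta> ^ Suc m"
      unfolding WA[symmetric] W\<zeta> by (simp add: power_mult_distrib)
    also have "\<dots> = poly (of_int_poly H) \<zeta>"
      unfolding B H_def by (simp add: hom_distribs)
    finally have H: "\<alpha> * of_int D ^ Suc m = poly (of_int_poly H) \<zeta>" .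
    obtain Q R where QR: "H = P * Q + R" "degree R < degree P" using monic_division[OF monic deg] .
    have "of_nat N * \<alpha> = poly (of_int_poly F) \<zeta>"
      using N r(1) by (simp add: F_def poly_of_int_sum_monom)
    moreover have "of_int D ^ Suc m * (of_nat N * \<alpha>) = of_nat N * poly (of_int_poly R) \<zeta>"
      using H pisot_poly_root[OF P] unfolding QR(1) by (simp add: hom_distribs mult_ac)
    ultimately have "poly (of_int_poly (Polynomial.smult (D ^ Suc m) F - Polynomial.smult (int N) R)) \<zeta> = 0"
      by (simp add: hom_distribs)
    moreover have "degree (Polynomial.smult (D ^ Suc m) F - Polynomial.smult (int N) R) < degree P"
    proof (rule degree_diff_less)
      have "degree F < k"
        using deg \<open>k = degree P\<close> unfolding F_def by (intro degree_sum_monom_less) simp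
      then show "degree (Polynomial.smult (D ^ Suc m) F) < degree P"
        using \<open>k = degree P\<close> by (intro le_less_trans[OF degree_smult_le]) simp
      show "degree (Polynomial.smult (int N) R) < degree P"
        using QR(2) by (intro le_less_trans[OF degree_smult_le])
    qed
    \<comment> \<open>Powers of \<open>\<zeta>\<close> below the degree are linearly independent, so
      equal values at \<open>\<zeta>\<close> give equal coefficients.\<close>
    ultimately have "Polynomial.smult (D ^ Suc m) F - Polynomial.smult (int N) R = 0"
      using pisot_poly_minimal_int[OF P] by (meson not_less)
    then have eq: "Polynomial.smult (D ^ Suc m) F = Polynomial.smult (int N) R" by simp
    show "int q dvd D"
    proof (rule ccontr)
      assume "\<not> int q dvd D"
      \<comment> \<open>As \<open>q\<close> divides \<open>N\<close> but not \<open>D\<close>, it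
        would divide every numerator, against the reduced form.\<close>
      have "int q dvd r j" if "j < k" for j
      proof -
        have "D ^ Suc m * r j = int N * coeff R j"
          using arg_cong[OF eq, of "\<lambda>p. coeff p j"] coeff_sum_monom_less[OF that, of r] by (simp add: F_def)
        then have "int q dvd D ^ Suc m * r j" using qN by (simp del: power_Suc)
        then show ?thesis
          using q \<open>\<not> int q dvd D\<close> prime_dvd_mult_iff prime_dvd_power by blast
      qed
      then have "int q dvd Gcd (insert (int N) (r ` {..<k}))"
        using qN by (intro Gcd_greatest) auto
      then show False using q unfolding r(2) by (simp add: not_prime_unit)
    qed
  next
    assume qD: "int q dvd D"
    \<comment> \<open>Otherwise some root \<open>x\<close> of \<open>P\<close> satisfies
      \<open>x * P'(x) = 0\<close>, but 0 is not a root and all roots are simple.\<close>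
    have "D \<noteq> 0"
    proof
      assume "D = 0"
      then obtain x where x: "x \<in> set xs" "poly (of_int_poly W) x = 0"
        using D by (auto simp: prod_list_zero_iff)
      then have root: "poly (of_int_poly P) x = 0"
        unfolding xs by (simp add: poly_prod_list o_def prod_list_zero_iff image_iff)
      then have "x \<noteq> 0"
        using pisot_poly_const_nonzero[OF P] \<zeta> by (auto simp: poly_0_coeff_0)
      then have "poly (pderiv (of_int_poly P)) x = 0"
        using x(2) by (simp add: W_def hom_distribs of_int_hom.map_poly_pderiv)
      then show False using pisot_poly_rsquarefree[OF P] root unfolding rsquarefree_roots by blast
    qed
    then have W0: "poly (of_int_poly W) \<zeta> \<noteq> 0" using WA by auto
    define \<alpha> where "\<alpha> = 1 / poly (of_int_poly W) \<zeta>"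
    \<comment> \<open>Here \<open>W * G\<close> is \<open>c\<close> modulo \<open>P\<close>, so
      taking norms shows that \<open>D\<close> divides \<open>c ^ k\<close>. With
      \<open>c = N\<close> this puts \<open>q\<close> into the denominator; with
      \<open>c = 1\<close> it keeps \<open>\<alpha>\<close> out of
      \<open>int_adjoin \<zeta>\<close>.\<close>
    have norm: "int q dvd c ^ k" if G: "\<alpha> * of_int c = poly (of_int_poly G) \<zeta>" for c G
    proof -
      obtain E B where E: "of_int E = (\<Prod>x\<leftarrow>xs. poly (of_int_poly G) x)"
        using norm_exists[OF monic deg xs dist] .
      have "poly (of_int_poly (W * G - [:c:])) \<zeta> = 0"
        using G W0 by (simp add: \<alpha>_def hom_distribs field_simps)
      then have "P dvd W * G - [:c:]" unfolding pisot_poly_dvd_iff[OF P] .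
      then have "D * E = c ^ k" using norm_mult_eq_power[OF xs _ D E] len by simp
      then show ?thesis using qD by (metis dvd_mult2)
    qed
    obtain Q R where QR: "A = P * Q + R" "degree R < degree P" using monic_division[OF monic deg] .
    \<comment> \<open>\<open>A\<close> inverts \<open>W\<close> up to the factor \<open>D\<close>;
      its remainder \<open>R\<close> modulo \<open>P\<close> supplies the \<open>k\<close>
      numerators.\<close>
    have "\<alpha> = poly (of_int_poly A) \<zeta> / of_int D"
      using WA W0 \<open>D \<noteq> 0\<close> by (simp add: \<alpha>_def field_simps)
    also have "\<dots> = (\<Sum>j<k. of_int (coeff R j) * \<zeta> ^ j) / of_int D"
      using QR(2) \<open>k = degree P\<close> poly_eq_sum_lessThan[of "of_int_poly R" k \<zeta>] pisot_poly_root[OF P]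
      unfolding QR(1) by (simp add: hom_distribs)
    finally obtain N where N: "has_denominator \<zeta> k \<alpha> N" using has_denominator_exists[OF \<open>D \<noteq> 0\<close>] by metis
    then obtain r where "N \<ge> 1" "\<alpha> = (\<Sum>j<k. of_int (r j) * \<zeta> ^ j) / of_nat N"
      unfolding has_denominator_def by blast
    then have "\<alpha> * of_int (int N) = poly (of_int_poly (\<Sum>j<k. monom (r j) j)) \<zeta>"
      by (simp add: poly_of_int_sum_monom)
    from norm[OF this] have "int q dvd int N" by (rule prime_dvd_power[OF q])
    then have "q dvd N" by simp
    moreover have "\<alpha> \<in> M_set \<zeta>"
      unfolding \<alpha>_def W\<zeta> by (rule inverse_pderiv_in_M_set[OF \<open>pisot \<zeta>\<close> P])
    moreover have "\<alpha> \<notin> int_adjoin \<zeta>"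
    proof
      assume "\<alpha> \<in> int_adjoin \<zeta>"
      then obtain G where "\<alpha> * of_int 1 = poly (of_int_poly G) \<zeta>"
        unfolding int_adjoin_def by auto
      from norm[OF this] show False using q by auto
    qed
    ultimately show "\<exists>\<alpha> \<in> M_set \<zeta> - int_adjoin \<zeta>. \<exists>N. has_denominator \<zeta> k \<alpha> N \<and> q dvd N"
      using N by blast
  qed
  also have "\<dots> \<longleftrightarrow> (\<exists>D :: int. of_int D = discriminant (map_poly of_int P) \<and> int q dvd D * poly P 0)"
    using norm_X_pderiv_dvd_iff[OF monic deg xs dist] D unfolding W_def .
  finally show ?thesis .
qed

end
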